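(* Let $Q=[Q_{i,j}]$ be a random symmetric $n\times n$ matrix whose entries $Q_{i,j}$, $1\le i\le j\le n$, are i.i.d. with a continuous cumulative distribution function $F$, and let $K_n$ be the support size of a global minimizer $\mathbf X^*$ of $\mathbf x^TQ\mathbf x$ over the standard simplex $\Delta_n$. Let $\alpha>e\sqrt2$ and $k_n=\lceil \alpha n^{1/2}\rceil$. Then, as $n\to\infty$, $$\Pr\{K_n\ge k_n\}=O\bigl(e^{\gamma(\alpha)n^{1/2}}\bigr),\qquad \gamma(\alpha):=2\alpha\log\bigl(e\sqrt2/\alpha\bigr)<0 .$$ So $K_n=O(n^{1/2})$ with probability sub-exponentially close to $1$.
   Context: $\Delta_n=\{\mathbf x\in\mathbb R^n:\ \mathbf x\ge \mathbf 0,\ \sum_{j}x_j=1\}$. The standard quadratic optimization problem (StQP) is to minimize $\mathbf x^TQ\mathbf x$ over $\mathbf x\in\Delta_n$. $\mathbf X^*$ denotes a global minimum solution of the StQP with the random matrix $Q$, and $K_n=|\{j\in[n]: X^*_j>0\}|$ is its support size. Here $\alpha$ is a fixed constant; the constant implied by $O(\cdot)$ does not depend on $n$. *)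

theory Defs
  imports "HOL-Probability.Probability" "HOL-Library.Landau_Symbols"
begin

text \<open>Since the dimension \<open>n\<close> tends to infinity, vectors and \<open>n \<times> n\<close> matrices are functions on
  indices, of which only the values at indices in \<open>{1..n}\<close> matter.\<close>

definition std_simplex :: "nat \<Rightarrow> (nat \<Rightarrow> real) set" where
  "std_simplex n = {x. (\<forall>j\<in>{1..n}. 0 \<le> x j) \<and> (\<Sum>j=1..n. x j) = 1}"

definition quad_form :: "nat \<Rightarrow> (nat \<Rightarrow> nat \<Rightarrow> real) \<Rightarrow> (nat \<Rightarrow> real) \<Rightarrow> real" where
  "quad_form n A x = (\<Sum>i=1..n. \<Sum>j=1..n. x i * A i j * x j)"

definition StQP_minimizer :: "nat \<Rightarrow> (nat \<Rightarrow> nat \<Rightarrow> real) \<Rightarrow> (nat \<Rightarrow> real) \<Rightarrow> bool" where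
  "StQP_minimizer n A x \<longleftrightarrow> is_arg_min (quad_form n A) (\<lambda>y. y \<in> std_simplex n) x"

definition support_size :: "nat \<Rightarrow> (nat \<Rightarrow> real) \<Rightarrow> nat" where
  "support_size n x = card {j\<in>{1..n}. x j > 0}"

definition iid_symmetric_matrix ::
    "'a measure \<Rightarrow> nat \<Rightarrow> (real \<Rightarrow> real) \<Rightarrow> ('a \<Rightarrow> nat \<Rightarrow> nat \<Rightarrow> real) \<Rightarrow> bool" where
  "iid_symmetric_matrix M n F Q \<longleftrightarrow>
     prob_space M \<and>
     (\<forall>\<omega>\<in>space M. \<forall>i\<in>{1..n}. \<forall>j\<in>{1..n}. Q \<omega> i j = Q \<omega> j i) \<and>
     prob_space.indep_vars M (\<lambda>_. borel) (\<lambda>(i, j) \<omega>. Q \<omega> i j)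
       {(i, j). 1 \<le> i \<and> i \<le> j \<and> j \<le> n} \<and>
     (\<forall>i j. 1 \<le> i \<and> i \<le> j \<and> j \<le> n \<longrightarrow> cdf (distr M borel (\<lambda>\<omega>. Q \<omega> i j)) = F)"

definition rate :: "real \<Rightarrow> real" where
  "rate \<alpha> = 2 * \<alpha> * ln (exp 1 * sqrt 2 / \<alpha>)"

end

theory Submission
  imports Defs
begin

text \<open>Let \<open>S\<close> be the support of a minimizer of \<open>x\<^sup>T A x\<close>. For two indices \<open>i\<close>, \<open>j\<close> of \<open>S\<close>, mass
  can be moved from \<open>i\<close> to \<open>j\<close> or from \<open>j\<close> to \<open>i\<close> without leaving the simplex. The minimizer therefore
  lies in the middle of a feasible segment of direction \<open>e\<^sub>i - e\<^sub>j\<close>, on which the form must be convex: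
  \<open>A i i + A j j - 2 A i j \<ge> 0\<close>. Hence every entry of \<open>A\<close> with both indices in \<open>S\<close> is at most the
  larger of the two diagonal entries in its row and column
  (\<open>StQP_minimizer_support_diag_dominated\<close>), and this passes to subsets of \<open>S\<close>. A large support thus
  contains an index set of size exactly \<open>k\<close> whose principal submatrix is dominated by its diagonal,
  a condition that no longer mentions the optimization problem.

  For a random matrix with i.i.d. entries on and above the diagonal and a continuous distribution
  function \<open>F\<close>, let \<open>h\<^sub>k(t)\<close> be the probability that a given \<open>k \<times> k\<close> principal submatrix is dominated by
  its diagonal and has all diagonal entries at most \<open>t\<close>. Conditioning on the value \<open>s\<close> of the largest
  diagonal entry, say in position \<open>m\<close>, splits the event into independent parts: the \<open>k - 1\<close> other
  entries in row \<open>m\<close> are at most \<open>s\<close>, and the remaining submatrix is of the same kind with the bound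
  \<open>s\<close>. With the \<open>k\<close> choices of \<open>m\<close> this gives
  \<open>h\<^sub>k(t) \<le> k \<integral>\<^bsub>s \<le> t\<^esub> F(s)\<^bsup>k-1\<^esup> h\<^sub>k\<^sub>-\<^sub>1(s) dF(s)\<close>, and since \<open>\<integral>\<^bsub>s \<le> t\<^esub> F(s)\<^bsup>p\<^esup> dF(s) = F(t)\<^bsup>p+1\<^esup> / (p + 1)\<close> for
  continuous \<open>F\<close>, induction yields \<open>h\<^sub>k(t) \<le> 2\<^bsup>k\<^esup> / (k + 1)! \<sqdot> F(t)\<^bsup>k(k+1)/2\<^esup>\<close> (\<open>prob_capped_le\<close>).

  The union bound over the \<open>n choose k\<close> index sets and the estimate \<open>k! \<ge> (k/e)\<^bsup>k\<^esup>\<close> then bound the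
  probability of a support of size at least \<open>k\<close> by \<open>(2e\<^sup>2n / k\<^sup>2)\<^bsup>k\<^esup>\<close>. For \<open>k \<ge> \<alpha>\<surd>n\<close> the base is at most
  \<open>(e\<surd>2 / \<alpha>)\<^sup>2 < 1\<close>, so the bound is at most \<open>(e\<surd>2 / \<alpha>)\<close> to the power \<open>2\<alpha>\<surd>n\<close>, which is
  \<open>exp (rate \<alpha> \<sqdot> \<surd>n)\<close>. The \<open>O\<close> bounds therefore hold with constant 1 for all \<open>n \<ge> 1\<close>.\<close>

section \<open>Second-order optimality on the support of a minimizer\<close>

text \<open>Adding the values at two opposite perturbations cancels the linear term, so only the
  curvature of the form in the direction \<open>v\<close> remains.\<close>

lemma quad_form_parallelogram:
  "quad_form n A (\<lambda>j. x j + v j) + quad_form n A (\<lambda>j. x j - v j)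
     = 2 * quad_form n A x + 2 * quad_form n A v"
  unfolding quad_form_def sum_distrib_left sum.distrib[symmetric]
  by (intro sum.cong refl) (simp add: algebra_simps)

lemma quad_form_exchange_direction:
  fixes d :: real
  assumes "i \<in> {1..n}" "j \<in> {1..n}" "i \<noteq> j"
  shows "quad_form n A (\<lambda>l. if l = i then d else if l = j then - d else 0)
           = d\<^sup>2 * (A i i + A j j - A i j - A j i)"
proof -
  let ?v = "\<lambda>l. if l = i then d else if l = j then - d else 0"
  have v: "?v l = d * of_bool (l = i) - d * of_bool (l = j)" for l
    using assms(3) by auto
  have sum_v: "(\<Sum>l=1..n. ?v l * f l) = d * f i - d * f j" for f
  proof -
    have "(\<Sum>l=1..n. ?v l * f l) = (\<Sum>l=1..n. d * (of_bool (l = i) * f l)) - (\<Sum>l=1..n. d * (of_bool (l = j) * f l))"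
      unfolding v sum_subtractf[symmetric] by (simp add: algebra_simps)
    then show ?thesis
      using assms(1,2) by (simp add: sum_distrib_left[symmetric])
  qed
  have "quad_form n A ?v = (\<Sum>k=1..n. ?v k * (\<Sum>l=1..n. ?v l * A k l))"
    unfolding quad_form_def sum_distrib_left by (intro sum.cong refl) (simp add: mult_ac)
  also have "\<dots> = d\<^sup>2 * (A i i + A j j - A i j - A j i)"
    unfolding sum_v by (simp add: algebra_simps power2_eq_square)
  finally show ?thesis .
qed

text \<open>The form is minimal at the midpoint of a feasible segment of direction \<open>e\<^sub>i - e\<^sub>j\<close>, so its second
  difference along this direction is nonnegative.\<close>

lemma StQP_minimizer_offdiag_le_mean_diag:
  assumes min: "StQP_minimizer n A x"
    and ij: "i \<in> {1..n}" "j \<in> {1..n}" and pos: "x i > 0" "x j > 0"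
    and sym: "A i j = A j i"
  shows "A i j \<le> (A i i + A j j) / 2"
proof (cases "i = j")
  case False
  \<comment> \<open>The longest step for which both \<open>x + v\<close> and \<open>x - v\<close> stay nonnegative.\<close>
  define d where "d = min (x i) (x j)"
  define v where "v = (\<lambda>l. if l = i then d else if l = j then - d else 0)"
  have "d > 0" using pos by (simp add: d_def)
  have x: "x \<in> std_simplex n"
    using min by (simp add: StQP_minimizer_def is_arg_min_def)
  have x_min: "quad_form n A x \<le> quad_form n A y" if "y \<in> std_simplex n" for y
    using min that by (auto simp: StQP_minimizer_def is_arg_min_linorder)
  have "sum v {1..n} = sum v {i, j}"
    using ij by (intro sum.mono_neutral_right) (auto simp: v_def)
  then have sum_v: "sum v {1..n} = 0"
    using False by (simp add: v_def)
  have "(\<lambda>l. x l + v l) \<in> std_simplex n" "(\<lambda>l. x l - v l) \<in> std_simplex n"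
    using x sum_v \<open>d > 0\<close>
    by (auto simp: std_simplex_def sum.distrib sum_subtractf v_def d_def)
  then have "0 \<le> quad_form n A v"
    using quad_form_parallelogram[of n A x v] x_min by (smt (verit, best))
  then have "0 \<le> A i i + A j j - 2 * A i j"
    using \<open>d > 0\<close> False ij sym
    by (simp add: v_def quad_form_exchange_direction zero_le_mult_iff)
  then show ?thesis by simp
qed auto

section \<open>Integration against a continuous distribution function\<close>

text \<open>\<open>I\<close> is the quantile function. Where the distribution function does not jump, it takes the
  value \<open>u\<close> exactly at the \<open>u\<close>-quantile: it is less than \<open>u\<close> to the left of it.\<close>

lemma (in cdf_distribution) cdf_I_eq:
  assumes cont: "isCont C (I u)" and u: "0 < u" "u < 1"
  shows "C (I u) = u"
proof (rule antisym)
  show "u \<le> C (I u)" by (rule iffD2[OF pseudoinverse[OF u] order_refl])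
  show "C (I u) \<le> u"
  proof (rule tendsto_upperbound)
    show "(C \<longlongrightarrow> C (I u)) (at_left (I u))"
      using cont unfolding isCont_def by (rule filterlim_mono) (simp_all add: at_le)
    have "C x \<le> u" if "x < I u" for x
      using iffD1[OF pseudoinverse[OF u], of x] that by (meson leD nle_le)
    then show "\<forall>\<^sub>F x in at_left (I u). C x \<le> u"
      unfolding eventually_at_filter by (intro always_eventually) auto
  qed simp
qed

text \<open>The measure is the image of the uniform distribution on \<open>(0, 1)\<close> under the quantile function, so
  the substitution \<open>x = I u\<close> turns the integral into that of \<open>u\<^bsup>p\<^esup>\<close> over \<open>[0, C t]\<close>.\<close>

lemma (in cdf_distribution) nn_integral_cdf_power:
  assumes cont: "continuous_on UNIV C"
  shows "(\<integral>\<^sup>+x. ennreal (C x ^ p) * indicator {..t} x \<partial>M) = ennreal (C t ^ Suc p / real (Suc p))"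
proof -
  have "(\<integral>\<^sup>+x. ennreal (C x ^ p) * indicator {..t} x \<partial>M)
      = (\<integral>\<^sup>+u. ennreal (C (I u) ^ p) * indicator {..t} (I u) \<partial>restrict_space lborel {0<..<1::real})"
    by (subst distr_I_eq_M[symmetric], subst nn_integral_distr) auto
  also have "\<dots> = (\<integral>\<^sup>+u. ennreal (u ^ p) * indicator {0..C t} u * indicator {0<..<1} u \<partial>lborel)"
  proof (subst nn_integral_restrict_space; (intro nn_integral_cong)?)
    fix u :: real
    show "ennreal (C (I u) ^ p) * indicator {..t} (I u) * indicator {0<..<1} u
        = ennreal (u ^ p) * indicator {0..C t} u * indicator {0<..<1} u"
    proof (cases "u \<in> {0<..<1}")
      case True
      then have "C (I u) = u"
        using cont by (intro cdf_I_eq) (auto simp: continuous_on_eq_continuous_at)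
      moreover have "(indicator {..t} (I u) :: ennreal) = indicator {0..C t} u"
        using True pseudoinverse[of u t] unfolding indicator_def atMost_iff atLeastAtMost_iff
        by (intro arg_cong[where f = of_bool]) auto
      ultimately show ?thesis by (simp only:)
    qed simp
  qed simp
  also have "\<dots> = (\<integral>\<^sup>+u. ennreal (u ^ p) * indicator {0..C t} u \<partial>lborel)"
  proof (rule nn_integral_cong_AE)
    show "AE u in lborel. ennreal (u ^ p) * indicator {0..C t} u * indicator {0<..<1} u
        = ennreal (u ^ p) * indicator {0..C t} u"
      using AE_lborel_singleton[of 0] AE_lborel_singleton[of 1]
    proof eventually_elim
      case (elim u)
      then show ?case using cdf_bounded_prob[of t] by (auto simp: indicator_def)
    qed
  qed
  also have "\<dots> = ennreal (C t ^ Suc p / real (Suc p) - 0 ^ Suc p / real (Suc p))"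
    by (intro nn_integral_FTC_Icc)
       (auto intro!: derivative_eq_intros simp: cdf_nonneg simp del: power_Suc)
  finally show ?thesis by simp
qed

text \<open>\<open>indep_var\<close> relates two random variables with values in the same type. Here a real entry must
  be independent of a tuple of entries; the lemma obtains its product law by projecting from a pair of
  tuples.\<close>

lemma (in prob_space) indep_var_joint_distr:
  assumes indep: "indep_var S W L Z" and g [measurable]: "g \<in> measurable S N"
  shows "distr M N (\<lambda>\<omega>. g (W \<omega>)) \<Otimes>\<^sub>M distr M L Z = distr M (N \<Otimes>\<^sub>M L) (\<lambda>\<omega>. (g (W \<omega>), Z \<omega>))"
proof -
  have W [measurable]: "W \<in> measurable M S" and Z [measurable]: "Z \<in> measurable M L"
    and joint: "distr M S W \<Otimes>\<^sub>M distr M L Z = distr M (S \<Otimes>\<^sub>M L) (\<lambda>\<omega>. (W \<omega>, Z \<omega>))"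
    using indep by (auto simp: indep_var_distribution_eq)
  interpret Z: prob_space "distr M L Z" by (rule prob_space_distr) simp
  have "distr M N (\<lambda>\<omega>. g (W \<omega>)) \<Otimes>\<^sub>M distr M L Z
      = distr (distr M S W) N g \<Otimes>\<^sub>M distr (distr M L Z) L (\<lambda>z. z)"
    by (simp add: distr_distr comp_def)
  also have "\<dots> = distr (distr M S W \<Otimes>\<^sub>M distr M L Z) (N \<Otimes>\<^sub>M L) (\<lambda>(w, z). (g w, z))"
    by (rule pair_measure_distr) (auto simp: distr_distr comp_def Z.sigma_finite_measure_axioms)
  also have "\<dots> = distr M (N \<Otimes>\<^sub>M L) (\<lambda>\<omega>. (g (W \<omega>), Z \<omega>))"
    unfolding joint by (subst distr_distr) (auto simp: comp_def)
  finally show ?thesis .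
qed

text \<open>Conditioning on \<open>D\<close>: by Fubini, the probability is the integral of the section probabilities over
  \<open>s \<le> t\<close> against the law of \<open>D\<close>, and these are at most \<open>c F(s)\<^bsup>p\<^esup>\<close>.\<close>

lemma (in prob_space) prob_section_le:
  assumes D [measurable]: "D \<in> borel_measurable M" and Z [measurable]: "Z \<in> measurable M L"
    and indep: "distr M borel D \<Otimes>\<^sub>M distr M L Z = distr M (borel \<Otimes>\<^sub>M L) (\<lambda>\<omega>. (D \<omega>, Z \<omega>))"
    and cdf: "cdf (distr M borel D) = F" and cont: "continuous_on UNIV F"
    and E: "E \<in> sets (borel \<Otimes>\<^sub>M L)"
    and bound: "\<And>s. prob {\<omega> \<in> space M. (s, Z \<omega>) \<in> E} \<le> c * F s ^ p" and "c \<ge> 0"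
  shows "prob {\<omega> \<in> space M. (D \<omega>, Z \<omega>) \<in> E \<and> D \<omega> \<le> t} \<le> c * F t ^ Suc p / real (Suc p)"
proof -
  interpret D: prob_space "distr M borel D" by (rule prob_space_distr) simp
  interpret D: cdf_distribution "distr M borel D"
    by unfold_locales auto
  interpret Z: prob_space "distr M L Z" by (rule prob_space_distr) simp
  define E' where "E' = E \<inter> ({..t} \<times> space L)"
  have E' [measurable]: "E' \<in> sets (borel \<Otimes>\<^sub>M L)"
    unfolding E'_def by (intro sets.Int E pair_measureI) auto
  have F_nonneg: "F s \<ge> 0" for s
    using D.cdf_nonneg cdf by simp
  have sect: "emeasure (distr M L Z) (Pair s -` E') \<le> ennreal (c * F s ^ p) * indicator {..t} s" for s
  proof -
    have "emeasure (distr M L Z) (Pair s -` E') = emeasure M {\<omega> \<in> space M. (s, Z \<omega>) \<in> E'}"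
      by (subst emeasure_distr) (auto intro!: arg_cong[where f = "emeasure M"] sets_Pair1)
    also have "\<dots> \<le> ennreal (c * F s ^ p) * indicator {..t} s"
      using bound[of s] measurable_space[OF Z]
      by (cases "s \<le> t") (auto simp: E'_def emeasure_eq_measure ennreal_leI cong: conj_cong)
    finally show ?thesis .
  qed
  have "emeasure M {\<omega> \<in> space M. (D \<omega>, Z \<omega>) \<in> E \<and> D \<omega> \<le> t}
      = emeasure (distr M (borel \<Otimes>\<^sub>M L) (\<lambda>\<omega>. (D \<omega>, Z \<omega>))) E'"
  proof (subst emeasure_distr)
    show "emeasure M {\<omega> \<in> space M. (D \<omega>, Z \<omega>) \<in> E \<and> D \<omega> \<le> t}
        = emeasure M ((\<lambda>\<omega>. (D \<omega>, Z \<omega>)) -` E' \<inter> space M)"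
      using measurable_space[OF Z]
      by (intro arg_cong[where f = "emeasure M"]) (auto simp: E'_def)
  qed measurable
  also have "\<dots> = emeasure (distr M borel D \<Otimes>\<^sub>M distr M L Z) E'"
    using indep by simp
  also have "\<dots> = (\<integral>\<^sup>+s. emeasure (distr M L Z) (Pair s -` E') \<partial>distr M borel D)"
    by (rule Z.emeasure_pair_measure_alt) simp
  also have "\<dots> \<le> (\<integral>\<^sup>+s. ennreal c * (ennreal (F s ^ p) * indicator {..t} s) \<partial>distr M borel D)"
    using \<open>c \<ge> 0\<close> F_nonneg
    by (intro nn_integral_mono) (use sect in \<open>simp add: ennreal_mult mult.assoc\<close>)
  also have "\<dots> = ennreal c * ennreal (F t ^ Suc p / real (Suc p))"
    using D.nn_integral_cdf_power[of p t] cont D.measurable_C cdf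
    by (subst nn_integral_cmult) auto
  also have "\<dots> = ennreal (c * F t ^ Suc p / real (Suc p))"
    using \<open>c \<ge> 0\<close> F_nonneg by (simp add: ennreal_mult[symmetric])
  finally show ?thesis
    using \<open>c \<ge> 0\<close> F_nonneg by (simp add: emeasure_eq_measure)
qed

section \<open>Matrices dominated by their diagonal\<close>

text \<open>Only the entries with \<open>i \<le> j\<close> form an independent family, so a symmetric matrix is handled
  through these entries alone; \<open>upair i j\<close> is the position that represents both \<open>(i, j)\<close> and
  \<open>(j, i)\<close>.\<close>

definition upair :: "nat \<Rightarrow> nat \<Rightarrow> nat \<times> nat" where
  "upair i j = (min i j, max i j)"

definition upper_triangle :: "nat set \<Rightarrow> (nat \<times> nat) set" where
  "upper_triangle S = {(i, j). i \<in> S \<and> j \<in> S \<and> i \<le> j}"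

definition diag_dominated :: "nat set \<Rightarrow> (nat \<times> nat \<Rightarrow> real) \<Rightarrow> bool" where
  "diag_dominated S q \<longleftrightarrow> (\<forall>i\<in>S. \<forall>j\<in>S. q (upair i j) \<le> max (q (i, i)) (q (j, j)))"

text \<open>The additional bound on the diagonal is what makes the induction on \<open>S\<close> work: removing the index
  of the largest diagonal entry leaves a matrix that is capped at this entry.\<close>

definition capped :: "nat set \<Rightarrow> real \<Rightarrow> (nat \<times> nat \<Rightarrow> real) \<Rightarrow> bool" where
  "capped S t q \<longleftrightarrow> diag_dominated S q \<and> (\<forall>i\<in>S. q (i, i) \<le> t)"

lemma upair_in_upper_triangle [simp]: "upair i j \<in> upper_triangle S \<longleftrightarrow> i \<in> S \<and> j \<in> S"
  by (auto simp: upair_def upper_triangle_def min_def max_def)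

lemma diag_in_upper_triangle [simp]: "(i, i) \<in> upper_triangle S \<longleftrightarrow> i \<in> S"
  by (simp add: upper_triangle_def)

lemma upair_eq_diag_iff [simp]:
  "upair i j = (m, m) \<longleftrightarrow> i = m \<and> j = m" "(m, m) = upair i j \<longleftrightarrow> i = m \<and> j = m"
  by (auto simp: upair_def min_def max_def)

lemma inj_upair: "inj (\<lambda>i. upair i m)"
  by (auto simp: inj_def upair_def min_def max_def split: if_splits)

lemma upper_triangle_mono: "S \<subseteq> T \<Longrightarrow> upper_triangle S \<subseteq> upper_triangle T"
  by (auto simp: upper_triangle_def)

lemma capped_cong:
  assumes "\<And>p. p \<in> upper_triangle S \<Longrightarrow> q p = r p"
  shows "capped S t q \<longleftrightarrow> capped S t r"
  using assms by (simp add: capped_def diag_dominated_def)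

text \<open>Let \<open>m\<close> be the index of the largest diagonal entry. Then domination in row \<open>m\<close> means that
  all entries of this row are at most \<open>q (m, m)\<close>.\<close>

lemma capped_remove_max:
  assumes "finite S" "S \<noteq> {}" "capped S t q"
  obtains m where "m \<in> S" "capped (S - {m}) (q (m, m)) q"
    "\<forall>i\<in>S - {m}. q (upair i m) \<le> q (m, m)" "q (m, m) \<le> t"
proof -
  obtain m where m: "m \<in> S" "q (m, m) = (MAX i\<in>S. q (i, i))"
    using obtains_MAX[OF assms(1,2), of "\<lambda>i. q (i, i)"] by metis
  have max: "q (i, i) \<le> q (m, m)" if "i \<in> S" for i
    using m(2) assms(1) that by simp
  show ?thesis
  proof (rule that[of m])
    show "\<forall>i\<in>S - {m}. q (upair i m) \<le> q (m, m)"
    proof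
      fix i assume "i \<in> S - {m}"
      then have "q (upair i m) \<le> max (q (i, i)) (q (m, m))"
        using assms(3) m(1) by (simp add: capped_def diag_dominated_def)
      then show "q (upair i m) \<le> q (m, m)"
        using max[of i] \<open>i \<in> S - {m}\<close> by simp
    qed
  qed (use assms(3) m(1) max in \<open>simp_all add: capped_def diag_dominated_def\<close>)
qed

lemma borel_measurable_pred_le:
  fixes f g :: "'a \<Rightarrow> real"
  shows "f \<in> borel_measurable N \<Longrightarrow> g \<in> borel_measurable N \<Longrightarrow> Measurable.pred N (\<lambda>x. f x \<le> g x)"
  by simp

lemma measurable_diag_dominated:
  assumes "finite S" "\<And>p. p \<in> upper_triangle S \<Longrightarrow> (\<lambda>x. f x p) \<in> borel_measurable N"
  shows "Measurable.pred N (\<lambda>x. diag_dominated S (f x))"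
  unfolding diag_dominated_def
  using assms by (intro pred_intros_finite borel_measurable_pred_le borel_measurable_max) auto

lemma measurable_capped:
  assumes "finite S" "\<And>p. p \<in> upper_triangle S \<Longrightarrow> (\<lambda>x. f x p) \<in> borel_measurable N"
    and "g \<in> borel_measurable N"
  shows "Measurable.pred N (\<lambda>x. capped S (g x) (f x))"
  unfolding capped_def using assms
  by (intro pred_intros_logic pred_intros_finite measurable_diag_dominated borel_measurable_pred_le) auto

section \<open>The probability of being dominated by the diagonal\<close>

text \<open>One step of the recursion. Given \<open>Y (m, m) = s\<close>, the entries indexed by \<open>S\<close> and the entries
  \<open>upair i m\<close> for \<open>i \<in> S\<close> are two disjoint independent blocks. The first is capped at \<open>s\<close> with
  probability at most \<open>c F(s)\<^bsup>a\<^esup>\<close>, the second is bounded by \<open>s\<close> with probability \<open>F(s)\<^bsup>card S\<^esup>\<close>, and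
  integrating over \<open>s \<le> t\<close> raises the exponent by one and divides by it.\<close>

lemma (in prob_space) prob_capped_insert_le:
  assumes S: "finite S" "m \<notin> S"
    and indep: "indep_vars (\<lambda>_. borel) Y (upper_triangle (insert m S))"
    and cdf: "\<And>p. p \<in> upper_triangle (insert m S) \<Longrightarrow> cdf (distr M borel (Y p)) = F"
    and cont: "continuous_on UNIV F"
    and bound: "\<And>s. prob {\<omega> \<in> space M. capped S s (\<lambda>p. Y p \<omega>)} \<le> c * F s ^ a" and "c \<ge> 0"
  shows "prob {\<omega> \<in> space M. capped S (Y (m, m) \<omega>) (\<lambda>p. Y p \<omega>) \<and>
             (\<forall>i\<in>S. Y (upair i m) \<omega> \<le> Y (m, m) \<omega>) \<and> Y (m, m) \<omega> \<le> t}
           \<le> c * F t ^ (a + card S + 1) / real (a + card S + 1)"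
proof -
  define T where "T = upper_triangle (insert m S)"
  define cross where "cross = (\<lambda>i. upair i m) ` S"
  define R where "R = T - {(m, m)}"
  define Z where "Z = (\<lambda>\<omega>. restrict (\<lambda>p. Y p \<omega>) R)"
  define L :: "((nat \<times> nat) \<Rightarrow> real) measure" where "L = PiM R (\<lambda>_. borel)"
  define E where "E = {sz \<in> space (borel \<Otimes>\<^sub>M L).
    capped S (fst sz) (snd sz) \<and> (\<forall>i\<in>S. snd sz (upair i m) \<le> fst sz)}"
  have Y [measurable]: "Y p \<in> borel_measurable M" if "p \<in> T" for p
    using indep that by (auto simp: indep_vars_def T_def)
  have sub: "upper_triangle S \<subseteq> R" "cross \<subseteq> R" "upper_triangle S \<inter> cross = {}"
    using S by (auto simp: R_def T_def cross_def) (auto simp: upper_triangle_def)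
  have diag: "(m, m) \<in> T" by (simp add: T_def)
  have ind: "indep_var (PiM {(m, m)} (\<lambda>_. borel)) (\<lambda>\<omega>. restrict (\<lambda>p. Y p \<omega>) {(m, m)}) L Z"
    unfolding L_def Z_def using indep
    by (rule indep_var_restrict) (auto simp: R_def T_def)
  have Z: "Z \<in> measurable M L"
    using ind by (simp add: indep_var_distribution_eq)
  have DZ: "distr M borel (Y (m, m)) \<Otimes>\<^sub>M distr M L Z
      = distr M (borel \<Otimes>\<^sub>M L) (\<lambda>\<omega>. (Y (m, m) \<omega>, Z \<omega>))"
    using indep_var_joint_distr[OF ind, of "\<lambda>z. z (m, m)" borel] by simp
  have E: "E \<in> sets (borel \<Otimes>\<^sub>M L)"
  proof -
    have [measurable]: "(\<lambda>sz. snd sz p) \<in> borel_measurable (borel \<Otimes>\<^sub>M L)" if "p \<in> R" for p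
      using that unfolding L_def by measurable
    have "Measurable.pred (borel \<Otimes>\<^sub>M L) (\<lambda>sz. capped S (fst sz) (snd sz))"
      using S sub by (intro measurable_capped) auto
    moreover have "Measurable.pred (borel \<Otimes>\<^sub>M L) (\<lambda>sz. \<forall>i\<in>S. snd sz (upair i m) \<le> fst sz)"
    proof (rule pred_intros_finite(3)[OF S(1)])
      fix i assume "i \<in> S"
      then have "upair i m \<in> R" using sub by (auto simp: cross_def)
      then show "Measurable.pred (borel \<Otimes>\<^sub>M L) (\<lambda>sz. snd sz (upair i m) \<le> fst sz)"
        by measurable
    qed
    ultimately show ?thesis unfolding E_def by measurable
  qed
  have Z_in: "Z \<omega> \<in> space L" for \<omega>
    by (simp add: Z_def L_def space_PiM)
  have EZ: "(s, Z \<omega>) \<in> E \<longleftrightarrow> capped S s (\<lambda>p. Y p \<omega>) \<and> (\<forall>i\<in>S. Y (upair i m) \<omega> \<le> s)" for s \<omega>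
  proof -
    have "capped S s (Z \<omega>) \<longleftrightarrow> capped S s (\<lambda>p. Y p \<omega>)"
      using sub by (intro capped_cong) (auto simp: Z_def)
    then show ?thesis
      using Z_in sub by (auto simp: E_def space_pair_measure Z_def cross_def)
  qed
  have F_nonneg: "F s \<ge> 0" for s
    using cdf[of "(m, m)"] by (auto simp: cdf_def)
  have "prob {\<omega> \<in> space M. (s, Z \<omega>) \<in> E} \<le> c * F s ^ (a + card S)" for s
  proof -
    let ?A = "{z \<in> space (PiM (upper_triangle S) (\<lambda>_. borel)). capped S s z}"
    let ?B = "PiE cross (\<lambda>_. {..s})"
    let ?YA = "\<lambda>\<omega>. restrict (\<lambda>p. Y p \<omega>) (upper_triangle S)"
    let ?YB = "\<lambda>\<omega>. restrict (\<lambda>p. Y p \<omega>) cross"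
    have fin: "finite cross" using S by (simp add: cross_def)
    have ind: "indep_var (PiM (upper_triangle S) (\<lambda>_. borel)) ?YA (PiM cross (\<lambda>_. borel)) ?YB"
      using sub by (intro indep_var_restrict[OF indep]) (auto simp: R_def T_def)
    have A: "?A \<in> sets (PiM (upper_triangle S) (\<lambda>_. borel))"
    proof -
      have "Measurable.pred (PiM (upper_triangle S) (\<lambda>_. borel)) (\<lambda>z :: nat \<times> nat \<Rightarrow> real. capped S s z)"
        using S by (intro measurable_capped) auto
      then show ?thesis by measurable
    qed
    have B: "?B \<in> sets (PiM cross (\<lambda>_. borel))"
      using fin by (intro sets_PiM_I_finite) auto
    have "{\<omega> \<in> space M. (s, Z \<omega>) \<in> E} = (\<lambda>\<omega>. (?YA \<omega>, ?YB \<omega>)) -` (?A \<times> ?B) \<inter> space M"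
      using capped_cong[of S "?YA \<omega>" "\<lambda>p. Y p \<omega>" s for \<omega>]
      by (auto simp: EZ space_PiM cross_def PiE_iff)
    then have "prob {\<omega> \<in> space M. (s, Z \<omega>) \<in> E}
        = prob (?YA -` ?A \<inter> space M) * prob (?YB -` ?B \<inter> space M)"
      using indep_varD[OF ind A B] by simp
    moreover have "?YA -` ?A \<inter> space M = {\<omega> \<in> space M. capped S s (\<lambda>p. Y p \<omega>)}"
      using capped_cong[of S "?YA \<omega>" "\<lambda>p. Y p \<omega>" s for \<omega>]
      by (auto simp: space_PiM)
    moreover have "prob (?YB -` ?B \<inter> space M) = F s ^ card S"
    proof (cases "S = {}")
      case False
      have "?YB -` ?B \<inter> space M = (\<Inter>p\<in>cross. Y p -` {..s} \<inter> space M)"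
        using False by (auto simp: cross_def PiE_iff)
      also have "prob \<dots> = (\<Prod>p\<in>cross. prob (Y p -` {..s} \<inter> space M))"
        using False sub fin by (intro indep_varsD[OF indep]) (auto simp: cross_def R_def T_def)
      also have "\<dots> = (\<Prod>p\<in>cross. F s)"
      proof (rule prod.cong[OF refl])
        fix p assume "p \<in> cross"
        then have p: "p \<in> T" using sub by (auto simp: R_def)
        then show "prob (Y p -` {..s} \<inter> space M) = F s"
          using cdf[of p] by (auto simp: cdf_def2 measure_distr T_def fun_eq_iff)
      qed
      also have "\<dots> = F s ^ card S"
        using inj_on_subset[OF inj_upair] by (simp add: cross_def card_image)
      finally show ?thesis .
    qed (simp add: cross_def prob_space restrict_def vimage_def)
    ultimately show ?thesis
      using mult_right_mono[OF bound[of s], of "F s ^ card S"] F_nonneg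
      by (simp add: power_add mult.assoc)
  qed
  from prob_section_le[OF Y[OF diag] Z DZ cdf cont E this \<open>c \<ge> 0\<close>, of t]
  show ?thesis
    by (simp add: EZ conj_assoc)
qed

text \<open>The exponent is the number \<open>1 + 2 + \<dots> + k\<close> of entries of the upper triangle for \<open>k = card S\<close>. The constants satisfy
  \<open>c\<^sub>0 = 1\<close> and \<open>c\<^sub>k = k c\<^sub>k\<^sub>-\<^sub>1 / (k(k+1)/2) = 2 c\<^sub>k\<^sub>-\<^sub>1 / (k+1)\<close>, where the factor \<open>k\<close> counts the
  positions of the largest diagonal entry.\<close>

lemma (in prob_space) prob_capped_le:
  assumes "finite S"
    and "indep_vars (\<lambda>_. borel) Y (upper_triangle S)"
    and "\<And>p. p \<in> upper_triangle S \<Longrightarrow> cdf (distr M borel (Y p)) = F"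
    and cont: "continuous_on UNIV F"
  shows "prob {\<omega> \<in> space M. capped S t (\<lambda>p. Y p \<omega>)}
           \<le> 2 ^ card S / fact (Suc (card S)) * F t ^ (card S * Suc (card S) div 2)"
  using assms(1-3)
proof (induction "card S" arbitrary: S t)
  case 0
  then show ?case by simp
next
  case (Suc k)
  define a where "a = k * Suc k div 2"
  define c :: real where "c = 2 ^ k / fact (Suc k)"
  have triangular: "Suc k * Suc (Suc k) div 2 = a + k + 1"
    unfolding a_def by simp
  have "2 * (a + k + 1) = Suc k * Suc (Suc k)"
    unfolding a_def by simp
  then have a: "2 * real (a + k + 1) = real (Suc k) * real (Suc (Suc k))"
    by (metis of_nat_mult of_nat_numeral)
  let ?E = "\<lambda>m. {\<omega> \<in> space M. capped (S - {m}) (Y (m, m) \<omega>) (\<lambda>p. Y p \<omega>) \<and>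
             (\<forall>i\<in>S - {m}. Y (upair i m) \<omega> \<le> Y (m, m) \<omega>) \<and> Y (m, m) \<omega> \<le> t}"
  have Y [measurable]: "Y p \<in> borel_measurable M" if "p \<in> upper_triangle S" for p
    using Suc.prems(2) that by (auto simp: indep_vars_def)
  have S: "S \<noteq> {}" using Suc.hyps by auto
  have E_sets: "?E m \<in> events" if "m \<in> S" for m
  proof -
    have "Measurable.pred M (\<lambda>\<omega>. capped (S - {m}) (Y (m, m) \<omega>) (\<lambda>p. Y p \<omega>))"
      using Suc.prems(1) that upper_triangle_mono[of "S - {m}" S]
      by (intro measurable_capped Y) auto
    moreover have "Measurable.pred M (\<lambda>\<omega>. \<forall>i\<in>S - {m}. Y (upair i m) \<omega> \<le> Y (m, m) \<omega>)"
      using Suc.prems(1) that by (intro pred_intros_finite borel_measurable_pred_le Y) auto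
    moreover have "Measurable.pred M (\<lambda>\<omega>. Y (m, m) \<omega> \<le> t)"
      using that by (intro borel_measurable_pred_le Y) auto
    ultimately show ?thesis by measurable
  qed
  have E_prob: "prob (?E m) \<le> c * F t ^ (a + k + 1) / real (a + k + 1)" if "m \<in> S" for m
  proof -
    have card: "k = card (S - {m})"
      using that Suc.prems(1) Suc.hyps(2) by auto
    have "prob {\<omega> \<in> space M. capped (S - {m}) s (\<lambda>p. Y p \<omega>)} \<le> c * F s ^ a" for s
      unfolding c_def a_def card
      using Suc.prems upper_triangle_mono[of "S - {m}" S]
      by (intro Suc.hyps(1)[OF card]) (auto intro: indep_vars_subset)
    then have "prob (?E m) \<le> c * F t ^ (a + card (S - {m}) + 1) / real (a + card (S - {m}) + 1)"
      using Suc.prems cont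
      by (intro prob_capped_insert_le) (auto simp: insert_absorb[OF that] c_def)
    then show ?thesis by (simp only: card[symmetric])
  qed
  have "prob {\<omega> \<in> space M. capped S t (\<lambda>p. Y p \<omega>)} \<le> prob (\<Union>m\<in>S. ?E m)"
  proof (rule finite_measure_mono)
    show "{\<omega> \<in> space M. capped S t (\<lambda>p. Y p \<omega>)} \<subseteq> (\<Union>m\<in>S. ?E m)"
    proof
      fix \<omega> assume "\<omega> \<in> {\<omega> \<in> space M. capped S t (\<lambda>p. Y p \<omega>)}"
      then show "\<omega> \<in> (\<Union>m\<in>S. ?E m)"
        using capped_remove_max[OF Suc.prems(1) S, of t "\<lambda>p. Y p \<omega>"] by blast
    qed
    show "(\<Union>m\<in>S. ?E m) \<in> events"
      using Suc.prems(1) E_sets by (intro sets.finite_UN) auto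
  qed
  also have "\<dots> \<le> (\<Sum>m\<in>S. prob (?E m))"
    using Suc.prems(1) E_sets by (intro finite_measure_subadditive_finite) auto
  also have "\<dots> \<le> (\<Sum>m\<in>S. c * F t ^ (a + k + 1) / real (a + k + 1))"
    by (intro sum_mono E_prob)
  also have "\<dots> = real (Suc k) * (c * F t ^ (a + k + 1) / real (a + k + 1))"
    using Suc.hyps(2) by simp
  also have "\<dots> = 2 * real (Suc k) * c / (2 * real (a + k + 1)) * F t ^ (a + k + 1)"
    by (simp only: mult.assoc times_divide_eq_left times_divide_eq_right mult_divide_mult_cancel_left)
  also have "\<dots> = 2 ^ Suc k / fact (Suc (Suc k)) * F t ^ (a + k + 1)"
    unfolding a c_def by (simp add: divide_simps del: of_nat_Suc)
  finally show ?case
    unfolding Suc.hyps(2)[symmetric] triangular .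
qed

text \<open>The limit of the previous bound as the cap \<open>t\<close> tends to infinity.\<close>

lemma (in prob_space) prob_diag_dominated_le:
  assumes S: "finite S"
    and indep: "indep_vars (\<lambda>_. borel) Y (upper_triangle S)"
    and cdf: "\<And>p. p \<in> upper_triangle S \<Longrightarrow> cdf (distr M borel (Y p)) = F"
    and cont: "continuous_on UNIV F"
  shows "prob {\<omega> \<in> space M. diag_dominated S (\<lambda>p. Y p \<omega>)} \<le> 2 ^ card S / fact (Suc (card S))"
proof -
  let ?A = "\<lambda>t :: nat. {\<omega> \<in> space M. capped S (real t) (\<lambda>p. Y p \<omega>)}"
  have Y: "Y p \<in> borel_measurable M" if "p \<in> upper_triangle S" for p
    using indep that by (auto simp: indep_vars_def)
  have meas: "range ?A \<subseteq> events"
    using measurable_capped[OF S, of "\<lambda>\<omega> p. Y p \<omega>" M] Y by (auto simp: pred_def)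
  have bound: "prob (?A t) \<le> 2 ^ card S / fact (Suc (card S))" for t
  proof (cases "S = {}")
    case False
    then obtain i where i: "i \<in> S" by auto
    interpret D: prob_space "distr M borel (Y (i, i))"
      using i by (intro prob_space_distr Y) simp
    have F: "0 \<le> F t" "F t \<le> 1" for t
      using cdf[of "(i, i)"] i D.prob_le_1 by (auto simp: cdf_def)
    show ?thesis
    proof (rule order_trans[OF prob_capped_le[OF S indep cdf cont]])
      show "2 ^ card S / fact (Suc (card S)) * F (real t) ^ (card S * Suc (card S) div 2)
          \<le> 2 ^ card S / fact (Suc (card S))"
        by (intro mult_left_le power_le_one F) simp
    qed
  qed simp
  have lim: "(\<lambda>t. prob (?A t)) \<longlonglongrightarrow> prob (\<Union>t. ?A t)"
    by (rule finite_Lim_measure_incseq[OF meas]) (force simp: incseq_def capped_def)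
  have "(\<Union>t. ?A t) = {\<omega> \<in> space M. diag_dominated S (\<lambda>p. Y p \<omega>)}"
  proof -
    have "\<exists>t :: nat. \<forall>i\<in>S. Y (i, i) \<omega> \<le> real t" for \<omega>
    proof -
      obtain t :: nat where t: "(\<Sum>i\<in>S. \<bar>Y (i, i) \<omega>\<bar>) \<le> real t"
        using real_arch_simple by blast
      have "Y (i, i) \<omega> \<le> real t" if "i \<in> S" for i
        using member_le_sum[OF that, of "\<lambda>i. \<bar>Y (i, i) \<omega>\<bar>"] S t by simp
      then show ?thesis by blast
    qed
    then show ?thesis by (auto simp: capped_def)
  qed
  then show ?thesis
    using LIMSEQ_le_const2[OF lim] bound by simp
qed

section \<open>The union bound over index sets\<close>

text \<open>\<open>k\<^bsup>k\<^esup> / k!\<close> is one of the terms of the series for \<open>e\<^bsup>k\<^esup>\<close>.\<close>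

lemma power_self_le_fact_exp: "real k ^ k \<le> fact k * exp (real k)"
proof -
  have "(\<Sum>j\<in>{k}. real k ^ j /\<^sub>R fact j) \<le> exp (real k)"
    unfolding exp_def by (rule sum_le_suminf) (auto simp: summable_exp)
  then show ?thesis by (simp add: divide_simps mult.commute)
qed

lemma binomial_times_power2_over_fact_le:
  assumes "k > 0"
  shows "real (n choose k) * (2 ^ k / fact (Suc k)) \<le> (2 * (exp 1)\<^sup>2 * real n / (real k)\<^sup>2) ^ k"
proof -
  have k: "real k ^ k > 0" using assms by simp
  have "real ((n choose k) * fact k) \<le> real (n ^ k)"
    unfolding of_nat_le_iff by (rule binomial_fact_pow)
  then have binom: "real (n choose k) \<le> real n ^ k / fact k"
    by (simp add: divide_simps)
  have inv: "1 / fact k \<le> exp 1 ^ k / real k ^ k"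
    using power_self_le_fact_exp[of k] k
    by (simp add: divide_simps exp_of_nat_mult[symmetric] mult.commute)
  have "real (n choose k) * (2 ^ k / fact (Suc k)) \<le> real (n choose k) * (2 ^ k / fact k)"
    by (intro mult_left_mono divide_left_mono fact_mono) auto
  also have "\<dots> \<le> real n ^ k / fact k * (2 ^ k / fact k)"
    by (intro mult_right_mono binom) auto
  also have "\<dots> = real n ^ k * 2 ^ k * ((1 / fact k) * (1 / fact k))"
    by simp
  also have "\<dots> \<le> real n ^ k * 2 ^ k * ((exp 1 ^ k / real k ^ k) * (exp 1 ^ k / real k ^ k))"
    by (intro mult_left_mono mult_mono inv) auto
  also have "\<dots> = (2 * (exp 1)\<^sup>2 * real n / (real k)\<^sup>2) ^ k"
    by (simp add: power_divide power_mult_distrib power2_eq_square)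
  finally show ?thesis .
qed

lemma rate_neg:
  assumes "\<alpha> > exp 1 * sqrt 2"
  shows "rate \<alpha> < 0"
proof -
  have "\<alpha> > 0" by (rule less_trans[OF _ assms]) simp
  moreover from this have "0 < exp 1 * sqrt 2 / \<alpha>" "exp 1 * sqrt 2 / \<alpha> < 1"
    using assms by simp_all
  ultimately show ?thesis
    unfolding rate_def by (intro mult_pos_neg) simp_all
qed

text \<open>Both the base and the exponent are compared with their values at \<open>k = \<alpha>\<surd>n\<close>. The comparison of
  the exponents reverses the order of the powers because the base \<open>b\<^sup>2\<close> is less than 1.\<close>

lemma power_le_exp_rate:
  assumes alpha: "\<alpha> > exp 1 * sqrt 2" and k: "real k \<ge> \<alpha> * sqrt (real n)" and "k > 0"
  shows "(2 * (exp 1)\<^sup>2 * real n / (real k)\<^sup>2) ^ k \<le> exp (rate \<alpha> * sqrt (real n))"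
proof -
  define b where "b = exp 1 * sqrt 2 / \<alpha>"
  have pos: "\<alpha> > 0" by (rule less_trans[OF _ alpha]) simp
  have b: "b > 0" "ln b < 0"
    using pos alpha by (simp_all add: b_def)
  have "2 * (exp 1)\<^sup>2 * real n / (real k)\<^sup>2 = b\<^sup>2 * ((\<alpha> * sqrt (real n))\<^sup>2 / (real k)\<^sup>2)"
    using pos by (simp add: b_def power_mult_distrib power_divide)
  also have "\<dots> \<le> b\<^sup>2 * 1"
    using k pos \<open>k > 0\<close> by (intro mult_left_mono) (auto simp: power_mono divide_le_eq)
  finally have "(2 * (exp 1)\<^sup>2 * real n / (real k)\<^sup>2) ^ k \<le> (b\<^sup>2) ^ k"
    by (intro power_mono) auto
  also have "\<dots> = exp (real k * (2 * ln b))"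
    using b by (simp add: exp_of_nat_mult exp_double)
  also have "\<dots> \<le> exp (rate \<alpha> * sqrt (real n))"
    using mult_right_mono_neg[OF k, of "2 * ln b"] b
    by (simp add: rate_def b_def mult_ac)
  finally show ?thesis .
qed

text \<open>The mean of two diagonal entries is replaced by the weaker bound by their maximum, because only the
  latter factorizes once the largest diagonal entry is fixed.\<close>

lemma StQP_minimizer_support_diag_dominated:
  assumes "StQP_minimizer n A x"
    and "\<And>i j. i \<in> {1..n} \<Longrightarrow> j \<in> {1..n} \<Longrightarrow> A i j = A j i"
    and "S \<subseteq> {j \<in> {1..n}. x j > 0}"
  shows "diag_dominated S (\<lambda>(i, j). A i j)"
  unfolding diag_dominated_def
proof (intro ballI)
  fix i j assume ij: "i \<in> S" "j \<in> S"
  then have "A i j \<le> (A i i + A j j) / 2"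
    using assms by (intro StQP_minimizer_offdiag_le_mean_diag[of n A x]) auto
  moreover have "(\<lambda>(i, j). A i j) (upair i j) = A i j"
    using assms(2)[of i j] ij assms(3) by (auto simp: upair_def min_def max_def subset_iff)
  ultimately show "(\<lambda>(i, j). A i j) (upair i j)
      \<le> max ((\<lambda>(i, j). A i j) (i, i)) ((\<lambda>(i, j). A i j) (j, j))"
    by (simp add: max_def)
qed

text \<open>A support of size at least \<open>k\<close> contains a dominated index set of size exactly \<open>k\<close>, so a single
  size has to be counted. The dominated events also serve as a measurable cover.\<close>

lemma prob_support_size_ge_le:
  assumes iid: "iid_symmetric_matrix M n F Q"
    and cont: "continuous_on UNIV F"
    and min: "\<And>\<omega>. \<omega> \<in> space M \<Longrightarrow> StQP_minimizer n (Q \<omega>) (X \<omega>)"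
  shows "measure M {\<omega> \<in> space M. support_size n (X \<omega>) \<ge> k}
           \<le> real (n choose k) * (2 ^ k / fact (Suc k))"
proof -
  interpret prob_space M using iid by (simp add: iid_symmetric_matrix_def)
  define Y where "Y = (\<lambda>(i, j) \<omega>. Q \<omega> i j)"
  define \<S> where "\<S> = {S. S \<subseteq> {1..n} \<and> card S = k}"
  let ?E = "\<lambda>S. {\<omega> \<in> space M. diag_dominated S (\<lambda>p. Y p \<omega>)}"
  have tri: "upper_triangle {1..n} = {(i, j). 1 \<le> i \<and> i \<le> j \<and> j \<le> n}"
    by (auto simp: upper_triangle_def)
  have indep: "indep_vars (\<lambda>_. borel) Y (upper_triangle {1..n})"
    using iid unfolding tri Y_def by (simp add: iid_symmetric_matrix_def)
  have cdf: "cdf (distr M borel (Y p)) = F" if "p \<in> upper_triangle {1..n}" for p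
    using iid that by (cases p) (simp add: iid_symmetric_matrix_def Y_def upper_triangle_def)
  have fin: "finite \<S>" unfolding \<S>_def by (rule finite_subset[of _ "Pow {1..n}"]) auto
  have card: "card \<S> = n choose k"
    unfolding \<S>_def using n_subsets[of "{1..n}" k] by simp
  have E_sets: "?E S \<in> events" if "S \<in> \<S>" for S
  proof -
    have S: "finite S" "upper_triangle S \<subseteq> upper_triangle {1..n}"
      using that upper_triangle_mono by (auto simp: \<S>_def finite_subset)
    then have "Y p \<in> borel_measurable M" if "p \<in> upper_triangle S" for p
      using indep that by (auto simp: indep_vars_def)
    then show ?thesis
      using measurable_diag_dominated[OF S(1), of "\<lambda>\<omega> p. Y p \<omega>" M] by (simp add: pred_def)
  qed
  have E_prob: "prob (?E S) \<le> 2 ^ k / fact (Suc k)" if "S \<in> \<S>" for S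
  proof -
    have S: "finite S" "upper_triangle S \<subseteq> upper_triangle {1..n}" "card S = k"
      using that upper_triangle_mono by (auto simp: \<S>_def finite_subset)
    show ?thesis
      using prob_diag_dominated_le[OF S(1) indep_vars_subset[OF indep S(2)] cdf cont] S(2,3)
      by auto
  qed
  have "prob {\<omega> \<in> space M. support_size n (X \<omega>) \<ge> k} \<le> prob (\<Union>S\<in>\<S>. ?E S)"
  proof (rule finite_measure_mono)
    show "{\<omega> \<in> space M. support_size n (X \<omega>) \<ge> k} \<subseteq> (\<Union>S\<in>\<S>. ?E S)"
    proof safe
      fix \<omega> assume \<omega>: "\<omega> \<in> space M" "support_size n (X \<omega>) \<ge> k"
      then obtain S where S: "S \<subseteq> {j \<in> {1..n}. X \<omega> j > 0}" "card S = k"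
        unfolding support_size_def by (meson obtain_subset_with_card_n)
      have "diag_dominated S (\<lambda>(i, j). Q \<omega> i j)"
        using iid \<omega>(1) S(1) min
        by (intro StQP_minimizer_support_diag_dominated[of n "Q \<omega>" "X \<omega>"])
           (auto simp: iid_symmetric_matrix_def)
      then have "diag_dominated S (\<lambda>p. Y p \<omega>)"
        by (simp add: Y_def case_prod_beta')
      then show "\<omega> \<in> (\<Union>S\<in>\<S>. ?E S)"
        using \<omega>(1) S by (intro UN_I[of S]) (auto simp: \<S>_def)
    qed
    show "(\<Union>S\<in>\<S>. ?E S) \<in> events"
      using fin E_sets by (intro sets.finite_UN) auto
  qed
  also have "\<dots> \<le> (\<Sum>S\<in>\<S>. prob (?E S))"
    using fin E_sets by (intro finite_measure_subadditive_finite) auto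
  also have "\<dots> \<le> (\<Sum>S\<in>\<S>. 2 ^ k / fact (Suc k))"
    by (intro sum_mono E_prob)
  also have "\<dots> = real (n choose k) * (2 ^ k / fact (Suc k))"
    by (simp add: card)
  finally show ?thesis .
qed

theorem theorem1p1:
  fixes M :: "nat \<Rightarrow> 'a measure"
    and Q :: "nat \<Rightarrow> 'a \<Rightarrow> nat \<Rightarrow> nat \<Rightarrow> real"
    and X :: "nat \<Rightarrow> 'a \<Rightarrow> nat \<Rightarrow> real"
    and K :: "nat \<Rightarrow> 'a \<Rightarrow> nat"
    and F :: "real \<Rightarrow> real"
    and \<alpha> :: real
  assumes F_cont: "continuous_on UNIV F"
    and Q_iid: "\<And>n. n \<ge> 1 \<Longrightarrow> iid_symmetric_matrix (M n) n F (Q n)"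
    and X_min: "\<And>n \<omega>. n \<ge> 1 \<Longrightarrow> \<omega> \<in> space (M n) \<Longrightarrow> StQP_minimizer n (Q n \<omega>) (X n \<omega>)"
    and K_def: "\<And>n \<omega>. K n \<omega> = support_size n (X n \<omega>)"
    and K_meas: "\<And>n. n \<ge> 1 \<Longrightarrow> K n \<in> measurable (M n) (count_space UNIV)"
    and alpha: "\<alpha> > exp 1 * sqrt 2"
  shows "(\<lambda>n. measure (M n) {\<omega> \<in> space (M n). K n \<omega> \<ge> nat \<lceil>\<alpha> * sqrt (real n)\<rceil>})
           \<in> O(\<lambda>n. exp (rate \<alpha> * sqrt (real n)))
       \<and> rate \<alpha> < 0
       \<and> (\<lambda>n. 1 - measure (M n) {\<omega> \<in> space (M n). real (K n \<omega>) \<le> \<alpha> * sqrt (real n)})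
           \<in> O(\<lambda>n. exp (rate \<alpha> * sqrt (real n)))"
proof -
  define k where "k = (\<lambda>n :: nat. nat \<lceil>\<alpha> * sqrt (real n)\<rceil>)"
  have pos: "\<alpha> > 0" by (rule less_trans[OF _ alpha]) simp
  have upper: "measure (M n) {\<omega> \<in> space (M n). K n \<omega> \<ge> k n} \<le> exp (rate \<alpha> * sqrt (real n))"
    if n: "n \<ge> 1" for n
  proof -
    have k: "real (k n) \<ge> \<alpha> * sqrt (real n)" "k n > 0"
      using pos n by (auto simp: k_def real_nat_ceiling_ge)
    have "measure (M n) {\<omega> \<in> space (M n). K n \<omega> \<ge> k n}
        \<le> real (n choose k n) * (2 ^ k n / fact (Suc (k n)))"
      unfolding K_def by (rule prob_support_size_ge_le[OF Q_iid[OF n] F_cont X_min[OF n]])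
    also have "\<dots> \<le> exp (rate \<alpha> * sqrt (real n))"
      using binomial_times_power2_over_fact_le[OF k(2)] power_le_exp_rate[OF alpha k]
      by (rule order_trans)
    finally show ?thesis .
  qed
  have compl: "1 - measure (M n) {\<omega> \<in> space (M n). real (K n \<omega>) \<le> \<alpha> * sqrt (real n)} \<in> {0..exp (rate \<alpha> * sqrt (real n))}"
    if n: "n \<ge> 1" for n
  proof -
    interpret prob_space "M n" using Q_iid[OF n] by (simp add: iid_symmetric_matrix_def)
    note [measurable] = K_meas[OF n]
    let ?A = "{\<omega> \<in> space (M n). real (K n \<omega>) \<le> \<alpha> * sqrt (real n)}"
    have A: "?A \<in> events" by measurable
    have "1 - prob ?A = prob (space (M n) - ?A)"
      by (rule prob_compl[OF A, symmetric])
    also have "\<dots> \<le> prob {\<omega> \<in> space (M n). K n \<omega> \<ge> k n}"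
      by (rule finite_measure_mono) (auto simp: k_def nat_le_iff ceiling_le_iff)
    also note upper[OF n]
    finally show ?thesis by simp
  qed
  have "(\<lambda>n. measure (M n) {\<omega> \<in> space (M n). K n \<omega> \<ge> k n}) \<in> O(\<lambda>n. exp (rate \<alpha> * sqrt (real n)))"
    by (rule bigoI[where c = 1]) (auto intro!: eventually_at_top_linorderI[of 1] upper)
  moreover have "(\<lambda>n. 1 - measure (M n) {\<omega> \<in> space (M n). real (K n \<omega>) \<le> \<alpha> * sqrt (real n)})
      \<in> O(\<lambda>n. exp (rate \<alpha> * sqrt (real n)))"
    by (rule bigoI[where c = 1]) (use compl in \<open>auto intro!: eventually_at_top_linorderI[of 1]\<close>)
  ultimately show ?thesis
    using rate_neg[OF alpha] by (simp add: k_def)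
qed

end
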